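(* Let $W(x,y)$ be a formal weight enumerator of degree $n$ of the form $W(x,y)=x^n+\sum_{i=d}^n A_i x^{n-i}y^i$ with $A_d\neq 0$, and suppose $d\ge 8$. Then in $\mathbf{C}[x,y]$ $$(xy)^{d-5}(x^4-y^4)^{d-5}(x^4+y^4)(x^4+6x^2y^2+y^4)\ \Big|\ xy(x^4-y^4)(D)\,W(x,y).$$
   Context: A formal weight enumerator is a homogeneous polynomial $W(x,y)=\sum_{i=0}^n A_i x^{n-i}y^i\in\mathbf{C}[x,y]$ such that (i) $A_i\neq 0$ implies $4\mid i$, and (ii) $W\left(\frac{x+y}{\sqrt 2},\frac{x-y}{\sqrt 2}\right)=-W(x,y)$. For a polynomial $p(x,y)$, $p(x,y)(D)$ denotes the differential operator $p\left(\frac{\partial}{\partial x},\frac{\partial}{\partial y}\right)$; thus $xy(x^4-y^4)(D)=\frac{\partial^2}{\partial x\partial y}\left(\frac{\partial^4}{\partial x^4}-\frac{\partial^4}{\partial y^4}\right)$. *)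

theory Defs
  imports "HOL-Computational_Algebra.Computational_Algebra" Complex_Main
begin

text \<open>
  \<open>C[x,y]\<close> is represented as \<open>C[x][y]\<close>: the inner indeterminate is \<open>x\<close>, the outer one is \<open>y\<close>,
  so the coefficient of \<open>x\<^sup>i y\<^sup>j\<close> in \<open>p\<close> is \<open>coeff (coeff p j) i\<close>.
\<close>

type_synonym bipoly = "complex poly poly"

definition const :: "complex \<Rightarrow> bipoly" where
  "const c = [:[:c:]:]"

definition varx :: bipoly where
  "varx = [:[:0, 1:]:]"

definition vary :: bipoly where
  "vary = [:0, 1:]"

definition subst2 :: "bipoly \<Rightarrow> bipoly \<Rightarrow> bipoly \<Rightarrow> bipoly" where
  "subst2 p a b =
     (\<Sum>j\<le>degree p. \<Sum>i\<le>degree (coeff p j). const (coeff (coeff p j) i) * a ^ i * b ^ j)"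

definition Dx :: "bipoly \<Rightarrow> bipoly" where
  "Dx p = map_poly pderiv p"

definition Dy :: "bipoly \<Rightarrow> bipoly" where
  "Dy p = pderiv p"

text \<open>\<open>diff_op p\<close> is the operator \<open>p(D) = p(\<partial>/\<partial>x, \<partial>/\<partial>y)\<close>.\<close>

definition diff_op :: "bipoly \<Rightarrow> bipoly \<Rightarrow> bipoly" where
  "diff_op p q =
     (\<Sum>j\<le>degree p. \<Sum>i\<le>degree (coeff p j).
        const (coeff (coeff p j) i) * (Dx ^^ i) ((Dy ^^ j) q))"

definition formal_weight_enumerator :: "nat \<Rightarrow> bipoly \<Rightarrow> bool" where
  "formal_weight_enumerator n W \<longleftrightarrow>
     (\<exists>A. W = (\<Sum>i=0..n. const (A i) * varx ^ (n - i) * vary ^ i) \<and>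
          (\<forall>i\<le>n. A i \<noteq> 0 \<longrightarrow> 4 dvd i)) \<and>
     subst2 W (const (1 / complex_of_real (sqrt 2)) * (varx + vary))
              (const (1 / complex_of_real (sqrt 2)) * (varx - vary)) = - W"

end

theory Submission imports Defs "HOL-Computational_Algebra.Field_as_Ring"
begin

text \<open>
  Let \<open>P = xy(x\<^sup>4 - y\<^sup>4)\<close>, \<open>Q = P(D)W\<close>, \<open>H : (x, y) \<mapsto> ((x+y)/\<surd>2, (x-y)/\<surd>2)\<close> and
  \<open>J : (x, y) \<mapsto> (x, \<i>y)\<close>. The chain rule turns the (semi-)invariance of \<open>P\<close> and \<open>W\<close> under \<open>H\<close> and \<open>J\<close>
  into \<open>Q \<circ> H = - Q\<close> and \<open>Q \<circ> J = - \<i> Q\<close>, so the divisors of \<open>Q\<close> are permuted by the group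
  generated by \<open>H\<close> and \<open>J\<close>.
  Since \<open>W - x\<^sup>n\<close> is divisible by \<open>y\<^sup>d\<close>, \<open>Q\<close> is divisible by \<open>y\<^bsup>d-5\<^esup>\<close>, hence by the powers of all six
  linear factors of \<open>P\<close>.
  The group also contains the scalar \<open>c = (1+\<i>)/\<surd>2\<close>, with \<open>Q(cx, cy) = - \<i> Q(x, y)\<close>, and the map
  \<open>(x, y) \<mapsto> (y, \<i>x)\<close>, with \<open>Q(y, \<i>x) = \<i> Q(x, y)\<close>. As \<open>c\<^sup>2 = \<i>\<close>, both agree on the line \<open>y = cx\<close>, so
  \<open>Q\<close> vanishes there. The orbit of this line consists of the zeros of
  \<open>(x\<^sup>4 + y\<^sup>4)(x\<^sup>4 + 6x\<^sup>2y\<^sup>2 + y\<^sup>4)(x\<^sup>4 - 6x\<^sup>2y\<^sup>2 + y\<^sup>4)\<close>.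
\<close>

section \<open>Constants and induction on bivariate polynomials\<close>

lemma const_hom: "const 0 = 0" "const 1 = 1" "const (a + b) = const a + const b" "const (a - b) = const a - const b"
  "const (- a) = - const a" "const (a * b) = const a * const b"
  by (simp_all add: const_def one_pCons)

lemma const_numeral: "const (numeral k) = numeral k"
  by (simp add: const_def numeral_poly)

text \<open>The constants and the two variables generate the ring, so identities for substitutions
  and derivations follow without inspecting coefficients.\<close>

lemma bipoly_induct [case_names const add varx vary]:
  assumes c: "\<And>c. P (const c)" and add: "\<And>p q. P p \<Longrightarrow> P q \<Longrightarrow> P (p + q)"
    and x: "\<And>p. P p \<Longrightarrow> P (varx * p)" and y: "\<And>p. P p \<Longrightarrow> P (vary * p)"
  shows "P p"
proof (induction p)
  case 0
  show ?case using c[of 0] by (simp add: const_hom)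
next
  case (pCons q p)
  have "P [:q:]"
  proof (induction q)
    case 0
    show ?case using c[of 0] by (simp add: const_hom)
  next
    case (pCons a q)
    have "[:pCons a q:] = const a + varx * [:q:]"
      by (simp add: const_def varx_def)
    then show ?case using add[OF c x[OF pCons.IH]] by metis
  qed
  moreover have "pCons q p = [:q:] + vary * p"
    by (simp add: vary_def)
  ultimately show ?case using add y pCons by simp
qed

section \<open>Substitution as a ring homomorphism\<close>

lemma poly_map_poly_eq_sum:
  fixes f :: "'a::zero \<Rightarrow> 'b::comm_semiring_1"
  assumes "f 0 = 0"
  shows "poly (map_poly f p) b = (\<Sum>j\<le>degree p. f (coeff p j) * b ^ j)"
proof -
  have "poly (map_poly f p) b = (\<Sum>j\<le>degree (map_poly f p). f (coeff p j) * b ^ j)"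
    unfolding poly_altdef by (simp add: coeff_map_poly assms)
  \<comment> \<open>\<open>f\<close> may kill leading coefficients, so \<open>map_poly f p\<close>
    can have smaller degree than \<open>p\<close>; the surplus terms are zero.\<close>
  also have "\<dots> = (\<Sum>j\<le>degree p. f (coeff p j) * b ^ j)"
    by (rule sum.mono_neutral_left)
      (auto simp: map_poly_degree_leq assms coeff_map_poly[of f, symmetric] intro: le_degree)
  finally show ?thesis .
qed

text \<open>Reading the double sum as a nested evaluation removes the degree bounds, which do not
  behave well under addition.\<close>

lemma subst2_eq_poly:
  "subst2 p a b = poly (map_poly (\<lambda>q. poly (map_poly const q) a) p) b"
  by (simp add: subst2_def poly_map_poly_eq_sum const_hom sum_distrib_right)

lemma map_poly_add_hom:
  assumes "f 0 = 0" "\<And>u v. f (u + v) = f u + f v"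
  shows "map_poly f (p + q) = map_poly f p + map_poly f q"
  by (rule poly_eqI) (simp add: coeff_map_poly assms)

lemma subst2_const: "subst2 (const c) a b = const c"
  by (simp add: subst2_eq_poly const_def[of c] map_poly_pCons const_hom)

lemma subst2_add: "subst2 (p + q) a b = subst2 p a b + subst2 q a b"
  unfolding subst2_eq_poly by (simp add: map_poly_add_hom const_hom)

lemma subst2_pCons: "subst2 (pCons q p) a b = poly (map_poly const q) a + b * subst2 p a b"
  unfolding subst2_eq_poly by (simp add: map_poly_pCons const_hom)

lemma subst2_vary_mult: "subst2 (vary * p) a b = b * subst2 p a b"
  by (simp add: vary_def subst2_pCons)

lemma subst2_varx_mult: "subst2 (varx * p) a b = a * subst2 p a b"
proof (induction p)
  case 0
  show ?case by (simp add: subst2_eq_poly)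
next
  case (pCons q p)
  have "varx * pCons q p = pCons ([:0,1:] * q) (varx * p)" by (simp add: varx_def)
  then show ?case using pCons(2)
    by (simp add: subst2_pCons map_poly_pCons const_hom algebra_simps)
qed

lemma subst2_mult: "subst2 (p * q) a b = subst2 p a b * subst2 q a b"
proof (induction p rule: bipoly_induct)
  case (const c)
  show ?case
  proof (induction q rule: bipoly_induct)
    case (varx p)
    then show ?case by (simp add: subst2_const mult.left_commute[of _ varx] subst2_varx_mult)
  next
    case (vary p)
    then show ?case by (simp add: subst2_const mult.left_commute[of _ vary] subst2_vary_mult)
  qed (simp_all add: subst2_const subst2_add distrib_left flip: const_hom)
qed (simp_all add: subst2_add distrib_right subst2_varx_mult subst2_vary_mult mult.assoc)

section \<open>Coprimality criteria\<close>

lemma coprime_varx_vary: "coprime varx vary"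
proof (rule coprimeI)
  fix g assume "g dvd varx" "g dvd vary"
  \<comment> \<open>\<open>varx\<close> has degree 0 in \<open>y\<close>, so its divisor
    \<open>g\<close> is some \<open>[:q:]\<close>; as \<open>g\<close> also divides
    \<open>vary\<close>, \<open>q\<close> divides the leading coefficient 1.\<close>
  then obtain q where q: "g = [:q:]"
    by (metis varx_def degree_pCons_0 dvd_imp_degree_le le_zero_eq degree_eq_zeroE pCons_eq_0_iff one_neq_zero)
  then have "q dvd 1" using \<open>g dvd vary\<close>
    by (metis vary_def const_poly_dvd_iff coeff_pCons_Suc coeff_pCons_0)
  then show "is_unit g" using q by (simp add: is_unit_const_poly_iff)
qed

lemma const_dvd_1:
  assumes "c \<noteq> 0"
  shows "const c dvd 1"
proof
  show "1 = const c * const (inverse c)"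
    using assms by (simp flip: const_hom(2,6))
qed

lemma numeral_dvd_1: "(numeral k :: bipoly) dvd 1"
  using const_dvd_1[of "numeral k"] by (simp add: const_numeral)

text \<open>\<open>C[x,y]\<close> is not a Bezout domain, so 1 need not be a combination of coprime
  forms. Reaching a power of each variable, up to units, suffices: a common divisor then divides two
  coprime powers.\<close>

lemma coprime_if_combinations:
  assumes "r * a + s * b = u * varx ^ k" "r' * a + s' * b = v * vary ^ l"
    and "u dvd 1" "v dvd 1"
  shows "coprime a b"
proof (rule coprimeI)
  fix g assume "g dvd a" "g dvd b"
  then have "g dvd u * varx ^ k" "g dvd v * vary ^ l"
    by (simp_all flip: assms(1,2))
  then have "g dvd varx ^ k" "g dvd vary ^ l"
    using assms(3,4) by (simp_all add: dvd_mult_unit_iff')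
  then show "is_unit g"
    using coprime_varx_vary by (meson coprime_common_divisor coprime_power_left_iff coprime_power_right_iff)
qed

section \<open>Substitution rules and the factor theorem\<close>

lemma subst2_varx: "subst2 varx a b = a"
  using subst2_varx_mult[of 1] subst2_const[of 1] by (simp add: const_hom)

lemma subst2_vary: "subst2 vary a b = b"
  using subst2_vary_mult[of 1] subst2_const[of 1] by (simp add: const_hom)

lemma subst2_0: "subst2 0 a b = 0" and subst2_1: "subst2 1 a b = 1"
  using subst2_const[of 0] subst2_const[of 1] by (simp_all add: const_hom)

lemma subst2_uminus: "subst2 (- p) a b = - subst2 p a b"
  using subst2_add[of p "- p" a b] by (simp add: subst2_0 add_eq_0_iff)

lemma subst2_diff: "subst2 (p - q) a b = subst2 p a b - subst2 q a b"
  using subst2_add[of p "- q"] by (simp add: subst2_uminus)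

lemma subst2_power: "subst2 (p ^ k) a b = subst2 p a b ^ k"
  by (induction k) (simp_all add: subst2_1 subst2_mult)

lemma subst2_sum: "subst2 (sum f S) a b = (\<Sum>i\<in>S. subst2 (f i) a b)"
  by (induction S rule: infinite_finite_induct) (simp_all add: subst2_0 subst2_add)

lemma subst2_numeral: "subst2 (numeral k) a b = numeral k"
  using subst2_const[of "numeral k"] by (simp add: const_numeral)

lemmas subst2_simps = subst2_const subst2_varx subst2_vary subst2_0 subst2_1 subst2_numeral
  subst2_add subst2_diff subst2_uminus subst2_mult subst2_power

lemma subst2_subst2: "subst2 (subst2 p a b) c e = subst2 p (subst2 a c e) (subst2 b c e)"
  by (induction p rule: bipoly_induct) (simp_all add: subst2_simps)

lemma subst2_dvd: "p dvd q \<Longrightarrow> subst2 p a b dvd subst2 q a b"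
  by (auto elim!: dvdE simp: subst2_mult)

text \<open>Factor theorem: modulo \<open>vary - a\<close>, the variable \<open>y\<close> may be
  replaced by \<open>a\<close>. With \<open>a\<close> a multiple of \<open>varx\<close>, it turns
  vanishing on a line into a linear factor.\<close>

lemma dvd_diff_subst2: "vary - a dvd p - subst2 p varx a"
proof (induction p rule: bipoly_induct)
  case (add p q)
  have "p + q - subst2 (p + q) varx a = (p - subst2 p varx a) + (q - subst2 q varx a)"
    by (simp add: subst2_add)
  then show ?case using dvd_add[OF add] by (simp only:)
next
  case (varx p)
  then show ?case by (simp add: subst2_simps flip: right_diff_distrib)
next
  case (vary p)
  have "vary * p - subst2 (vary * p) varx a = vary * (p - subst2 p varx a) + (vary - a) * subst2 p varx a"
    by (simp add: subst2_simps algebra_simps)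
  then show ?case using vary by simp
qed (simp add: subst2_const)

section \<open>Partial derivatives and the chain rule\<close>

lemma Dx_simps: "Dx (const c) = 0" "Dx varx = 1" "Dx vary = 0"
  by (simp_all add: Dx_def const_def varx_def vary_def map_poly_pCons one_pCons pderiv_pCons)

lemma Dy_simps: "Dy (const c) = 0" "Dy varx = 0" "Dy vary = 1"
  by (simp_all add: Dy_def const_def varx_def vary_def one_pCons pderiv_pCons)

lemma Dx_add: "Dx (p + q) = Dx p + Dx q"
  by (simp add: Dx_def map_poly_add_hom pderiv_add)

lemma Dy_add: "Dy (p + q) = Dy p + Dy q"
  by (simp add: Dy_def pderiv_add)

lemma pderiv_sum: "pderiv (sum f A) = (\<Sum>i\<in>A. pderiv (f i))"
  by (induction A rule: infinite_finite_induct) (simp_all add: pderiv_add)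

lemma Dx_mult: "Dx (p * q) = Dx p * q + p * Dx q"
proof (rule poly_eqI)
  show "coeff (Dx (p * q)) n = coeff (Dx p * q + p * Dx q) n" for n
    by (simp add: Dx_def coeff_map_poly coeff_mult pderiv_sum pderiv_mult sum.distrib)
      (simp add: mult.commute add.commute)
qed

lemma Dy_mult: "Dy (p * q) = Dy p * q + p * Dy q"
  by (simp add: Dy_def pderiv_mult algebra_simps)

lemma Dy_Dx: "Dy (Dx p) = Dx (Dy p)"
  by (rule poly_eqI)
    (simp add: Dx_def Dy_def coeff_map_poly coeff_pderiv of_nat_poly pderiv_smult pderiv_mult pderiv_pCons)

lemma Dx_uminus: "Dx (- p) = - Dx p" and Dy_uminus: "Dy (- p) = - Dy p"
  using Dx_add[of p "- p"] Dy_add[of p "- p"] by (simp_all add: Dx_def Dy_def add_eq_0_iff)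

lemma Dx_diff: "Dx (p - q) = Dx p - Dx q" and Dy_diff: "Dy (p - q) = Dy p - Dy q"
  using Dx_add[of p "- q"] Dy_add[of p "- q"] by (simp_all add: Dx_uminus Dy_uminus)

text \<open>Chain rule, proved once for any derivation that kills constants, so that it serves both
  \<open>Dx\<close> and \<open>Dy\<close>.\<close>

lemma derivation_subst2:
  assumes "\<And>c. D (const c) = 0" "\<And>p q. D (p + q) = D p + D q" "\<And>p q. D (p * q) = D p * q + p * D q"
  shows "D (subst2 p a b) = subst2 (Dx p) a b * D a + subst2 (Dy p) a b * D b"
  by (induction p rule: bipoly_induct)
    (simp_all add: assms subst2_simps Dx_simps Dy_simps Dx_add Dy_add Dx_mult Dy_mult algebra_simps)

lemmas Dx_subst2 = derivation_subst2[of Dx, OF Dx_simps(1) Dx_add Dx_mult]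

lemmas Dy_subst2 = derivation_subst2[of Dy, OF Dy_simps(1) Dy_add Dy_mult]

lemma vary_power_dvd_Dx: "vary ^ k dvd p \<Longrightarrow> vary ^ k dvd Dx p"
proof -
  have "Dx (vary ^ k) = 0"
    by (induction k) (simp_all add: Dx_mult Dx_simps Dx_simps(1)[of 1, unfolded const_hom])
  then show "vary ^ k dvd p \<Longrightarrow> vary ^ k dvd Dx p" by (auto elim!: dvdE simp: Dx_mult)
qed

lemma vary_power_dvd_Dy: "vary ^ k dvd p \<Longrightarrow> vary ^ (k - 1) dvd Dy p"
proof (cases k)
  case (Suc m)
  have "vary ^ m dvd Dy (vary ^ Suc m)"
    by (simp add: Dy_def pderiv_power_Suc dvd_smult del: power_Suc)
  then have "vary ^ m dvd Dy (vary ^ Suc m * q)" for q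
    unfolding Dy_mult[of "vary ^ Suc m"] by (intro dvd_add dvd_mult2) simp_all
  moreover assume "vary ^ k dvd p"
  ultimately show ?thesis using Suc by (metis dvdE diff_Suc_1)
qed simp

section \<open>The operator \<open>P(D)\<close> under \<open>H\<close> and \<open>J\<close>\<close>

lemma diff_op_octahedral_form:
  "diff_op (varx * vary * (varx ^ 4 - vary ^ 4)) p
     = Dx (Dx (Dx (Dx (Dx (Dy p))))) - Dx (Dy (Dy (Dy (Dy (Dy p)))))"
proof -
  \<comment> \<open>Positions in the outer list are exponents of \<open>y\<close>: the only nonzero
    entries are \<open>x^5\<close> at \<open>y\<close> and \<open>-x\<close> at
    \<open>y^5\<close>.\<close>
  have *: "varx * vary * (varx ^ 4 - vary ^ 4) = [:0, [:0,0,0,0,0,1:], 0, 0, 0, [:0, -1:]:]"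
    by (simp add: varx_def vary_def eval_nat_numeral one_pCons)
  show ?thesis
    unfolding diff_op_def * by (simp add: atMost_Suc const_hom eval_nat_numeral)
qed

text \<open>The chain rule expresses the derivatives of \<open>h p\<close> through
  \<open>h (Dx p)\<close> and \<open>h (Dy p)\<close>; this linear system is its own inverse because
  \<open>2 * \<sigma>\<^sup>2 = 1\<close>.\<close>

lemma subst2_hadamard_Dx_Dy:
  fixes \<sigma> :: complex and p :: bipoly
  assumes "2 * \<sigma>\<^sup>2 = 1"
  defines "h \<equiv> \<lambda>p. subst2 p (const \<sigma> * (varx + vary)) (const \<sigma> * (varx - vary))"
  shows "h (Dx p) = const \<sigma> * (Dx (h p) + Dy (h p))"
    and "h (Dy p) = const \<sigma> * (Dx (h p) - Dy (h p))"
proof -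
  have *: "2 * const \<sigma> * const \<sigma> = 1"
    using assms(1) by (simp add: power2_eq_square mult.assoc flip: const_hom(2,6) const_numeral)
  have x: "Dx (h p) = const \<sigma> * (h (Dx p) + h (Dy p))"
    and y: "Dy (h p) = const \<sigma> * (h (Dx p) - h (Dy p))"
    by (simp_all add: h_def Dx_subst2 Dy_subst2 Dx_mult Dy_mult Dx_simps Dy_simps Dx_add Dy_add
        Dx_diff Dy_diff algebra_simps)
  show "h (Dx p) = const \<sigma> * (Dx (h p) + Dy (h p))"
    unfolding x y using * by algebra
  show "h (Dy p) = const \<sigma> * (Dx (h p) - Dy (h p))"
    unfolding x y using * by algebra
qed

text \<open>Moving \<open>h\<close> inside replaces \<open>(Dx, Dy)\<close> by
  \<open>\<sigma>(Dx + Dy, Dx - Dy)\<close>. Under this change \<open>P\<close> is multiplied by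
  \<open>8 * \<sigma>^6 = 1\<close>.\<close>

lemma subst2_hadamard_diff_op:
  fixes \<sigma> :: complex and p :: bipoly
  assumes "2 * \<sigma>\<^sup>2 = 1"
  defines "h \<equiv> \<lambda>p. subst2 p (const \<sigma> * (varx + vary)) (const \<sigma> * (varx - vary))"
  shows "h (diff_op (varx * vary * (varx ^ 4 - vary ^ 4)) p)
    = diff_op (varx * vary * (varx ^ 4 - vary ^ 4)) (h p)"
proof -
  have *: "2 * const \<sigma> ^ 2 = 1"
    using assms(1) by (simp add: power2_eq_square flip: const_hom(2,6) const_numeral)
  have 8: "8 * const \<sigma> ^ 6 = 1"
    using * by algebra
  have D: "Dx (const c * q) = const c * Dx q" "Dy (const c * q) = const c * Dy q" for c q
    by (simp_all add: Dx_mult Dy_mult Dx_simps Dy_simps)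
  have Dh: "h (Dx q) = const \<sigma> * (Dx (h q) + Dy (h q))"
     "h (Dy q) = const \<sigma> * (Dx (h q) - Dy (h q))" for q
    unfolding h_def using subst2_hadamard_Dx_Dy[OF assms(1)] by blast+
  have diff: "h (a - b) = h a - h b" for a b
    by (simp add: h_def subst2_diff)
  show ?thesis
    unfolding diff_op_octahedral_form diff Dh D Dx_add Dy_add Dx_diff Dy_diff Dy_Dx using 8 by algebra
qed

text \<open>Each \<open>Dy\<close> contributes a factor \<open>-\<i>\<close>. The terms of
  \<open>P(D)\<close> contain one and five of them, and \<open>(-\<i>)^5 = -\<i>\<close>, so the
  factor is common.\<close>

lemma subst2_diag_diff_op:
  fixes p :: bipoly
  defines "j \<equiv> \<lambda>p. subst2 p varx (const \<i> * vary)"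
  shows "j (diff_op (varx * vary * (varx ^ 4 - vary ^ 4)) p)
    = - (const \<i> * diff_op (varx * vary * (varx ^ 4 - vary ^ 4)) (j p))"
proof -
  have *: "const \<i> * const \<i> = - 1"
    by (simp flip: const_hom(6)) (simp add: const_hom)
  have D: "Dx (const c * q) = const c * Dx q" "Dy (const c * q) = const c * Dy q" for c q
    by (simp_all add: Dx_mult Dy_mult Dx_simps Dy_simps)
  have x: "j (Dx q) = Dx (j q)" and y: "Dy (j q) = const \<i> * j (Dy q)" for q
    by (simp_all add: j_def Dx_subst2 Dy_subst2 Dx_mult Dy_mult Dx_simps Dy_simps)
  have y: "j (Dy q) = - (const \<i> * Dy (j q))" for q
    unfolding y using * by algebra
  have diff: "j (a - b) = j a - j b" for a b
    by (simp add: j_def subst2_diff)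
  show ?thesis
    unfolding diff_op_octahedral_form diff x y D Dx_uminus Dy_uminus using * by algebra
qed

text \<open>Every term of \<open>P(D)\<close> contains a \<open>Dy\<close>, which kills
  \<open>x^n\<close>; at most five derivatives in \<open>y\<close> then cost at most five powers of
  \<open>y\<close>.\<close>

lemma vary_power_dvd_diff_op:
  assumes "vary ^ d dvd W - varx ^ n"
  shows "vary ^ (d - 5) dvd diff_op (varx * vary * (varx ^ 4 - vary ^ 4)) W"
proof -
  have "Dy (varx ^ n) = 0"
    by (induction n) (simp_all add: Dy_mult Dy_simps Dy_simps(1)[of 1, unfolded const_hom])
  then have "Dy W = Dy (W - varx ^ n)"
    by (simp add: Dy_diff)
  then have 1: "vary ^ (d - 1) dvd Dy W"
    using vary_power_dvd_Dy[OF assms] by simp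
  have "vary ^ (d - 5) dvd Dx (Dx (Dx (Dx (Dx (Dy W)))))"
    by (intro vary_power_dvd_Dx dvd_trans[OF le_imp_power_dvd 1]) simp
  moreover have "vary ^ (d - 1 - 1 - 1 - 1 - 1) dvd Dy (Dy (Dy (Dy (Dy W))))"
    by (intro vary_power_dvd_Dy 1)
  then have "vary ^ (d - 5) dvd Dx (Dy (Dy (Dy (Dy (Dy W)))))"
    by (simp add: vary_power_dvd_Dx numeral_eq_Suc)
  ultimately show ?thesis
    unfolding diff_op_octahedral_form by (rule dvd_diff)
qed

section \<open>Divisors of a semi-invariant polynomial\<close>

lemma dvd_if_semi_invariant:
  fixes Q :: bipoly and \<sigma> :: complex
  assumes \<sigma>: "2 * \<sigma>\<^sup>2 = 1"
    and h: "subst2 Q (const \<sigma> * (varx + vary)) (const \<sigma> * (varx - vary)) = - Q"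
    and j: "subst2 Q varx (const \<i> * vary) = - (const \<i> * Q)"
    and m: "vary ^ m dvd Q"
  shows "(varx * vary) ^ m * (varx ^ 4 - vary ^ 4) ^ m * (varx ^ 4 + vary ^ 4)
           * (varx ^ 4 + 6 * varx ^ 2 * vary ^ 2 + vary ^ 4) dvd Q"
proof -
  define H where "H p = subst2 p (const \<sigma> * (varx + vary)) (const \<sigma> * (varx - vary))" for p
  define J where "J p = subst2 p varx (const \<i> * vary)" for p
  define s I where "s = const \<sigma>" and "I = const \<i>"
  have I: "I * I = - 1"
    unfolding I_def by (simp flip: const_hom(6)) (simp add: const_hom)
  have I2: "I * (I * p) = - p" for p
    by (simp add: I flip: mult.assoc)
  have s: "2 * s * s = 1"
    using \<sigma> unfolding s_def by (simp add: power2_eq_square mult.assoc flip: const_hom(2,6) const_numeral)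
  have HQ: "H Q = - Q" and JQ: "J Q = - (I * Q)"
    using h j by (simp_all add: H_def J_def I_def)
  have Hs: "H varx = s * (varx + vary)" "H vary = s * (varx - vary)" "H I = I" "H s = s"
      "H (- p) = - H p" "H (p + q) = H p + H q" "H (p - q) = H p - H q" "H (p * q) = H p * H q"
      "H (p ^ k) = H p ^ k" "H (numeral w) = numeral w" for p q k w
    by (simp_all add: H_def s_def I_def subst2_simps)
  have Js: "J varx = varx" "J vary = I * vary" "J I = I" "J s = s" "J 1 = 1"
      "J (- p) = - J p" "J (p + q) = J p + J q" "J (p - q) = J p - J q" "J (p * q) = J p * J q"
      "J (p ^ k) = J p ^ k" "J (numeral w) = numeral w" for p q k w
    by (simp_all add: J_def s_def I_def subst2_simps)
  have H_dvd: "H p dvd Q" if "p dvd Q" for p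
    using subst2_dvd[OF that] HQ unfolding H_def by (metis dvd_minus_iff)
  have I_unit: "I dvd 1"
    by (rule dvdI[of _ _ "- I"]) (simp add: I)
  have J_dvd: "J p dvd Q" if "p dvd Q" for p
  proof -
    have "J p dvd I * Q"
      using subst2_dvd[OF that] JQ unfolding J_def by (metis dvd_minus_iff)
    then show ?thesis by (simp add: dvd_mult_unit_iff' I_unit)
  qed

  define c where "c = s * (1 + I)"
  have c2: "c * c = I"
    unfolding c_def using I s by algebra
  have c_const: "c = const (\<sigma> * (1 + \<i>))"
    by (simp add: c_def s_def I_def const_hom)
  \<comment> \<open>Composites of substitutions are determined by the images of the two
    variables.\<close>
  have "J (H (J (H (J (H p))))) = subst2 p (c * varx) (c * vary)" for p
  proof -
    have "J (H (J (H (J (H p))))) = subst2 p (J (H (J (H (J (H varx)))))) (J (H (J (H (J (H vary))))))"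
      unfolding H_def J_def by (simp only: subst2_subst2 subst2_varx subst2_vary)
    moreover have "J (H (J (H (J (H varx))))) = c * varx"
      unfolding Hs Js c_def using I s by algebra
    moreover have "J (H (J (H (J (H vary))))) = c * vary"
      unfolding Hs Js c_def using I s by algebra
    ultimately show ?thesis by simp
  qed
  \<comment> \<open>Three \<open>H\<close> and three \<open>J\<close> give the factor
    \<open>(-1)^3 * (-I)^3 = -I\<close>.\<close>
  from this[of Q] have scal: "subst2 Q (c * varx) (c * vary) = - (I * Q)"
    by (simp add: HQ JQ Hs Js I2)
  have "H (J (J (H (J p)))) = subst2 p vary (I * varx)" for p
  proof -
    have "H (J (J (H (J p)))) = subst2 p (H (J (J (H (J varx))))) (H (J (J (H (J vary)))))"
      unfolding H_def J_def by (simp only: subst2_subst2 subst2_varx subst2_vary)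
    moreover have "H (J (J (H (J varx)))) = vary"
      unfolding Hs Js using I s by algebra
    moreover have "H (J (J (H (J vary)))) = I * varx"
      unfolding Hs Js using I s by algebra
    ultimately show ?thesis by simp
  qed
  \<comment> \<open>Two \<open>H\<close> and three \<open>J\<close> give the factor
    \<open>(-I)^3 = I\<close>.\<close>
  from this[of Q] have swap: "subst2 Q vary (I * varx) = I * Q"
    by (simp add: HQ JQ Hs Js I2)
  define e where "e = subst2 Q varx (c * varx)"
  \<comment> \<open>On the line both \<open>scal\<close> and \<open>swap\<close> evaluate
    \<open>Q\<close> at \<open>(c * varx, I * varx)\<close>, with opposite factors.\<close>
  have "- (I * e) = subst2 (subst2 Q (c * varx) (c * vary)) varx (c * varx)"
    unfolding scal by (simp add: e_def I_def subst2_simps)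
  also have "\<dots> = subst2 Q (c * varx) (I * varx)"
    unfolding subst2_subst2 by (simp add: c_const subst2_simps) (simp flip: c_const mult.assoc add: c2)
  also have "\<dots> = subst2 (subst2 Q vary (I * varx)) varx (c * varx)"
    unfolding subst2_subst2 by (simp add: I_def subst2_simps)
  also have "\<dots> = I * e"
    unfolding swap by (simp add: e_def I_def subst2_simps)
  finally have "e = 0"
    using I by algebra
  then have l1: "vary - c * varx dvd Q"
    using dvd_diff_subst2[of "c * varx" Q] by (simp add: e_def)
  have c_unit: "c dvd 1"
    by (rule dvdI[of _ _ "- I * c"]) (simp add: mult.left_commute[of c] c2 I)
  \<comment> \<open>\<open>J\<close> applied twice is \<open>y -> -y\<close>. The two lines multiply
    to \<open>y^2 - I x^2\<close>, and one more \<open>J\<close> supplies the conjugate factor,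
    completing \<open>x^4 + y^4\<close>.\<close>
  have "J (J (vary - c * varx)) = - (vary + c * varx)"
    unfolding Js c_def using I by algebra
  then have l2: "vary + c * varx dvd Q"
    using J_dvd[OF J_dvd[OF l1]] by (simp only: minus_dvd_iff)
  have "coprime (vary - c * varx) (vary + c * varx)"
    by (rule coprime_if_combinations[of "-1" _ 1 _ "2 * c" 1 1 1 2 1])
      (simp_all add: numeral_dvd_1 c_unit is_unit_mult_iff)
  from divides_mult[OF l1 l2 this] have q1: "vary\<^sup>2 - I * varx\<^sup>2 dvd Q"
  proof (rule dvd_trans[rotated])
    show "vary\<^sup>2 - I * varx\<^sup>2 dvd (vary - c * varx) * (vary + c * varx)"
      by (rule dvdI[of _ _ 1]) (unfold c2[symmetric], algebra)
  qed
  have "J (vary\<^sup>2 - I * varx\<^sup>2) = - (vary\<^sup>2 + I * varx\<^sup>2)"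
    unfolding Js using I by algebra
  then have q2: "vary\<^sup>2 + I * varx\<^sup>2 dvd Q"
    using J_dvd[OF q1] by (simp only: minus_dvd_iff)
  have "coprime (vary\<^sup>2 - I * varx\<^sup>2) (vary\<^sup>2 + I * varx\<^sup>2)"
    by (rule coprime_if_combinations[of "-1" _ 1 _ "2 * I" 2 1 1 2 2])
      (simp_all add: numeral_dvd_1 I_unit is_unit_mult_iff)
  from divides_mult[OF q1 q2 this] have F3: "varx ^ 4 + vary ^ 4 dvd Q"
  proof (rule dvd_trans[rotated])
    show "varx ^ 4 + vary ^ 4 dvd (vary\<^sup>2 - I * varx\<^sup>2) * (vary\<^sup>2 + I * varx\<^sup>2)"
      by (rule dvdI[of _ _ 1]) (use I in algebra)
  qed
  let ?F4 = "varx ^ 4 + 6 * varx\<^sup>2 * vary\<^sup>2 + vary ^ 4"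
  have "?F4 dvd H (varx ^ 4 + vary ^ 4)"
    by (rule dvdI[of _ _ "2 * s ^ 4"]) (unfold Hs, algebra)
  then have F4: "?F4 dvd Q"
    using H_dvd[OF F3] by (rule dvd_trans)

  note power_left = coprime_power_left_iff[THEN iffD2, OF disjI1]
    and power_right = coprime_power_right_iff[THEN iffD2, OF disjI1]
    and mult_left = coprime_mult_left_iff[THEN iffD2, OF conjI]
  have right_power_dvd: "p ^ m dvd Q" if "(u * p) ^ m dvd Q" for u p
    using that by (simp add: power_mult_distrib dvd_mult_right)
  \<comment> \<open>\<open>H\<close> is an involution, so reaching \<open>x\<close> from
    \<open>y\<close> takes a detour: up to units, \<open>H\<close>, \<open>J J\<close>,
    \<open>H\<close> send \<open>y\<close> to \<open>x - y\<close>, \<open>x + y\<close>,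
    \<open>x\<close>.\<close>
  have "(s * (varx - vary)) ^ m dvd Q"
    using H_dvd[OF m] by (simp only: Hs)
  then have "J (J ((varx - vary) ^ m)) dvd Q"
    by (rule J_dvd[OF J_dvd[OF right_power_dvd]])
  moreover have "J (J ((varx - vary) ^ m)) = (varx + vary) ^ m"
    by (simp add: Js I flip: mult.assoc)
  ultimately have "(varx + vary) ^ m dvd Q"
    by (simp only:)
  then have "H ((varx + vary) ^ m) dvd Q"
    by (rule H_dvd)
  moreover have "H (varx + vary) = (2 * s) * varx"
    unfolding Hs by algebra
  ultimately have "((2 * s) * varx) ^ m dvd Q"
    by (simp only: Hs)
  then have "varx ^ m dvd Q"
    by (rule right_power_dvd)
  moreover have "coprime (varx ^ m) (vary ^ m)"
    by (rule power_left[OF power_right[OF coprime_varx_vary]])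
  ultimately have F1: "(varx * vary) ^ m dvd Q"
    unfolding power_mult_distrib by (intro divides_mult m)
  have "H ((varx * vary) ^ m) = (s\<^sup>2 * (varx\<^sup>2 - vary\<^sup>2)) ^ m"
    unfolding Hs by (rule arg_cong[of _ _ "\<lambda>p. p ^ m"]) algebra
  then have "(s\<^sup>2 * (varx\<^sup>2 - vary\<^sup>2)) ^ m dvd Q"
    using H_dvd[OF F1] by (simp only:)
  then have d1: "(varx\<^sup>2 - vary\<^sup>2) ^ m dvd Q"
    by (rule right_power_dvd)
  have "J ((varx\<^sup>2 - vary\<^sup>2) ^ m) = (varx\<^sup>2 + vary\<^sup>2) ^ m"
    unfolding Js by (rule arg_cong[of _ _ "\<lambda>p. p ^ m"]) (use I in algebra)
  then have d2: "(varx\<^sup>2 + vary\<^sup>2) ^ m dvd Q"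
    using J_dvd[OF d1] by (simp only:)
  have "coprime (varx\<^sup>2 - vary\<^sup>2) (varx\<^sup>2 + vary\<^sup>2)"
    by (rule coprime_if_combinations[of 1 _ 1 _ 2 2 "-1" 1 2 2]) (simp_all add: numeral_dvd_1)
  then have "coprime ((varx\<^sup>2 - vary\<^sup>2) ^ m) ((varx\<^sup>2 + vary\<^sup>2) ^ m)"
    by (intro power_left power_right)
  moreover have d12: "(varx\<^sup>2 - vary\<^sup>2) * (varx\<^sup>2 + vary\<^sup>2) = varx ^ 4 - vary ^ 4"
    by algebra
  ultimately have F2: "(varx ^ 4 - vary ^ 4) ^ m dvd Q"
    unfolding d12[symmetric] power_mult_distrib by (intro divides_mult d1 d2)

  \<comment> \<open>For the pairs with \<open>xy\<close>: multiply the other form by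
    \<open>x^4\<close> or \<open>y^4\<close> and cancel all terms but the eighth power, each of them
    being divisible by \<open>xy\<close>.\<close>
  have c12: "coprime (varx * vary) (varx ^ 4 - vary ^ 4)"
    by (rule coprime_if_combinations[of "varx ^ 3 * vary ^ 3" _ "varx ^ 4" _ 1 8
          "varx ^ 3 * vary ^ 3" "- (vary ^ 4)" 1 8], algebra, algebra, simp_all)
  have c13: "coprime (varx * vary) (varx ^ 4 + vary ^ 4)"
    by (rule coprime_if_combinations[of "- (varx ^ 3 * vary ^ 3)" _ "varx ^ 4" _ 1 8
          "- (varx ^ 3 * vary ^ 3)" "vary ^ 4" 1 8], algebra, algebra, simp_all)
  have c14: "coprime (varx * vary) ?F4"
    by (rule coprime_if_combinations[of "- (6 * varx ^ 5 * vary + varx ^ 3 * vary ^ 3)" _ "varx ^ 4" _ 1 8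
          "- (6 * vary ^ 5 * varx + varx ^ 3 * vary ^ 3)" "vary ^ 4" 1 8], algebra, algebra, simp_all)
  have c23: "coprime (varx ^ 4 - vary ^ 4) (varx ^ 4 + vary ^ 4)"
    by (rule coprime_if_combinations[of 1 _ 1 _ 2 4 "-1" 1 2 4]) (simp_all add: numeral_dvd_1)
  \<comment> \<open>Division in \<open>X = x^2\<close>, \<open>Y = y^2\<close>: the form
    \<open>X^2 + 6XY + Y^2\<close> equals \<open>8 X^2\<close> on \<open>X = Y\<close> and
    \<open>-4 X^2\<close> on \<open>X = -Y\<close>, whence the constants 8 and 4.\<close>
  have "coprime (varx\<^sup>2 - vary\<^sup>2) ?F4"
    by (rule coprime_if_combinations[of "7 * varx\<^sup>2 + vary\<^sup>2" _ 1 _ 8 4 "- (varx\<^sup>2 + 7 * vary\<^sup>2)" 1 8 4],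
        algebra, algebra, simp_all add: numeral_dvd_1)
  moreover have "coprime (varx\<^sup>2 + vary\<^sup>2) ?F4"
    by (rule coprime_if_combinations[of "5 * varx\<^sup>2 + vary\<^sup>2" _ "-1" _ 4 4 "varx\<^sup>2 + 5 * vary\<^sup>2" "-1" 4 4],
        algebra, algebra, simp_all add: numeral_dvd_1)
  ultimately have "coprime ((varx\<^sup>2 - vary\<^sup>2) * (varx\<^sup>2 + vary\<^sup>2)) ?F4"
    by (rule coprime_mult_left_iff[THEN iffD2, OF conjI])
  then have c24: "coprime (varx ^ 4 - vary ^ 4) ?F4"
    by (simp only: d12)
  have c34: "coprime (varx ^ 4 + vary ^ 4) ?F4"
    by (rule coprime_if_combinations[of "6 * varx\<^sup>2 + vary\<^sup>2" _ "- (vary\<^sup>2)" _ 6 6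
          "6 * vary\<^sup>2 + varx\<^sup>2" "- (varx\<^sup>2)" 6 6],
        algebra, algebra, simp_all add: numeral_dvd_1)
  \<comment> \<open>The four factors divide \<open>Q\<close> separately; pairwise coprimality,
    carried over to powers and partial products, gives the product.\<close>
  show ?thesis
    by (intro divides_mult F1 F2 F3 F4 mult_left power_left[OF power_right[OF c12]]
        power_left[OF c13] power_left[OF c14] power_left[OF c23] power_left[OF c24] c34)
qed

section \<open>Semi-invariance of \<open>Q\<close> for a formal weight enumerator\<close>

theorem theorem5p4:
  fixes W :: bipoly and n d :: nat and A :: "nat \<Rightarrow> complex"
  assumes "formal_weight_enumerator n W"
    and "W = varx ^ n + (\<Sum>i=d..n. const (A i) * varx ^ (n - i) * vary ^ i)"
    and "d \<le> n" and "A d \<noteq> 0"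
    and "d \<ge> 8"
  shows "(varx * vary) ^ (d - 5) * (varx ^ 4 - vary ^ 4) ^ (d - 5) * (varx ^ 4 + vary ^ 4)
           * (varx ^ 4 + 6 * varx ^ 2 * vary ^ 2 + vary ^ 4)
         dvd diff_op (varx * vary * (varx ^ 4 - vary ^ 4)) W"
proof (rule dvd_if_semi_invariant)
  let ?\<sigma> = "1 / complex_of_real (sqrt 2)"
  show \<sigma>: "2 * ?\<sigma>\<^sup>2 = 1"
    by (simp add: power_divide flip: of_real_power)
  have h: "subst2 W (const ?\<sigma> * (varx + vary)) (const ?\<sigma> * (varx - vary)) = - W"
    using assms(1) by (simp add: formal_weight_enumerator_def)
  have diff_op_uminus: "diff_op (varx * vary * (varx ^ 4 - vary ^ 4)) (- W)
      = - diff_op (varx * vary * (varx ^ 4 - vary ^ 4)) W"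
    by (simp add: diff_op_octahedral_form Dx_uminus Dy_uminus)
  show "subst2 (diff_op (varx * vary * (varx ^ 4 - vary ^ 4)) W)
      (const ?\<sigma> * (varx + vary)) (const ?\<sigma> * (varx - vary))
      = - diff_op (varx * vary * (varx ^ 4 - vary ^ 4)) W"
    unfolding subst2_hadamard_diff_op[OF \<sigma>] h diff_op_uminus ..
  obtain B where B: "W = (\<Sum>i=0..n. const (B i) * varx ^ (n - i) * vary ^ i)"
     "\<forall>i\<le>n. B i \<noteq> 0 \<longrightarrow> 4 dvd i"
    using assms(1) unfolding formal_weight_enumerator_def by blast
  have I4: "const \<i> ^ 4 = 1"
    by (simp add: eval_nat_numeral flip: const_hom(6)) (simp add: const_hom)
  \<comment> \<open>Only exponents of \<open>y\<close> divisible by 4 occur, and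
    \<open>\<i>^4 = 1\<close>, so \<open>J\<close> fixes \<open>W\<close> term by term.\<close>
  have "const (B i) * varx ^ (n - i) * (const \<i> * vary) ^ i = const (B i) * varx ^ (n - i) * vary ^ i"
    if "i \<le> n" for i
  proof (cases "B i = 0")
    case False
    then obtain k where "i = 4 * k" using B(2) \<open>i \<le> n\<close> by blast
    then show ?thesis by (simp add: power_mult_distrib power_mult[of "const \<i>"] I4)
  qed (simp add: const_hom)
  then have j: "subst2 W varx (const \<i> * vary) = W"
    unfolding B(1) subst2_sum by (intro sum.cong) (simp_all add: subst2_simps del: mult_cancel_left)
  show "subst2 (diff_op (varx * vary * (varx ^ 4 - vary ^ 4)) W) varx (const \<i> * vary)
      = - (const \<i> * diff_op (varx * vary * (varx ^ 4 - vary ^ 4)) W)"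
    unfolding subst2_diag_diff_op j ..
  have "vary ^ d dvd (\<Sum>i=d..n. const (A i) * varx ^ (n - i) * vary ^ i)"
    by (intro dvd_sum dvd_mult le_imp_power_dvd) simp
  then show "vary ^ (d - 5) dvd diff_op (varx * vary * (varx ^ 4 - vary ^ 4)) W"
    by (intro vary_power_dvd_diff_op[of d _ n]) (simp add: assms(2))
qed

end
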